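(* Let $\mathcal{X}\subseteq\mathbb{R}^n$ be nonempty and compact, $B\in\mathbb{R}^{n\times r}$, $\mathcal{Y}_B=B^{\mathsf T}\mathcal{X}$ and $P_B=\operatorname{conv}(\mathcal{Y}_B)\subseteq\mathbb{R}^r$. Let $y^\star$ be an optimal shadow, let $\widehat z\in\mathbb{R}^r$ satisfy $\lVert\widehat z-y^\star\rVert_2\le\varepsilon$, and let $\widehat y$ be any maximizer of $y\mapsto\langle\widehat z,y\rangle$ over $P_B$. Then $$\lVert\widehat y-y^\star\rVert_2\le2\varepsilon .$$ If $R:=\lVert y^\star\rVert_2$, then $$0\le\lVert y^\star\rVert_2^2-\lVert\widehat y\rVert_2^2\le4R\varepsilon .$$ If $\mathcal{Y}_B=\{y^\star\}$, then $\widehat y=y^\star$. Otherwise, if $\mathcal{Y}_B$ is finite and $$\delta:=\min\{\lVert y-y^\star\rVert_2: y\in\mathcal{Y}_B,\ y\ne y^\star\}>0,$$ then $\varepsilon<\delta/2$ implies $\widehat y=y^\star$.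
   Context: An optimal shadow is a vector $y^\star=B^{\mathsf T}x^\star$ where $x^\star$ maximizes $x^{\mathsf T}BB^{\mathsf T}x=\lVert B^{\mathsf T}x\rVert_2^2$ over $x\in\mathcal{X}$; that is, a point of $\mathcal{Y}_B$ of maximum Euclidean norm. *)

theory Defs
  imports "HOL-Analysis.Analysis"
begin

definition shadow_set :: "real^'r^'n \<Rightarrow> (real^'n) set \<Rightarrow> (real^'r) set" where
  "shadow_set B X = (\<lambda>x. transpose B *v x) ` X"

definition shadow_hull :: "real^'r^'n \<Rightarrow> (real^'n) set \<Rightarrow> (real^'r) set" where
  "shadow_hull B X = convex hull (shadow_set B X)"

definition optimal_shadow :: "real^'r^'n \<Rightarrow> (real^'n) set \<Rightarrow> real^'r \<Rightarrow> bool" where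
  "optimal_shadow B X y \<longleftrightarrow>
     (\<exists>x. is_arg_max (\<lambda>x. x \<bullet> ((B ** transpose B) *v x)) (\<lambda>x. x \<in> X) x \<and> y = transpose B *v x)"

text \<open>The minimal distance from \<open>y\<close> to the other shadows. As \<open>Min\<close> is unspecified on empty and on
  infinite sets, this is meaningful only if \<open>shadow_set B X\<close> is finite and not contained
  in \<open>{y}\<close>.\<close>

definition shadow_gap :: "real^'r^'n \<Rightarrow> (real^'n) set \<Rightarrow> real^'r \<Rightarrow> real" where
  "shadow_gap B X y = Min {norm (z - y) |z. z \<in> shadow_set B X \<and> z \<noteq> y}"

lemma shadow_quadratic_form:
  fixes B :: "real^'r^'n"
  shows "x \<bullet> ((B ** transpose B) *v x) = (norm (transpose B *v x))\<^sup>2"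
  by (simp add: power2_norm_eq_inner dot_lmul_matrix flip: matrix_vector_mul_assoc)

lemma optimal_shadow_iff_is_arg_max_norm:
  "optimal_shadow B X y \<longleftrightarrow> is_arg_max norm (\<lambda>y. y \<in> shadow_set B X) y"
  unfolding optimal_shadow_def is_arg_max_def shadow_set_def shadow_quadratic_form
  by (auto simp: not_less dest: power_mono[OF _ norm_ge_zero, of _ _ 2] power2_le_imp_le)

end

theory Submission
  imports Defs
begin

text \<open>Every point \<open>y\<close> of the hull satisfies \<open>norm y \<le> norm ystar\<close>. Expanding \<open>norm y\<close> around
  \<open>ystar\<close> turns this into a bound of \<open>(norm (y - ystar))\<^sup>2\<close> by \<open>- 2 * (ystar \<bullet> (y - ystar))\<close>, which is
  at most \<open>2 * ((zhat - ystar) \<bullet> (y - ystar))\<close> as soon as \<open>zhat\<close> weakly prefers \<open>y\<close> to \<open>ystar\<close>.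
  In the finite case this estimate excludes all shadows except \<open>ystar\<close> from the closed half-space
  \<open>zhat \<bullet> y \<ge> zhat \<bullet> ystar\<close>. The open complementary half-space together with \<open>ystar\<close> is convex, so it
  contains the whole hull, and \<open>ystar\<close> is the only maximizer even among the non-extreme points.\<close>

text \<open>Stated for any \<open>y\<close> that \<open>z\<close> weakly prefers to
  \<open>p\<close>, so that it serves both for \<open>yhat\<close> and for excluding rival
  shadows.\<close>

lemma norm_diff_le_of_inner_ge:
  fixes y p z :: "'a::real_inner"
  assumes "norm y \<le> norm p" "z \<bullet> p \<le> z \<bullet> y" "norm (z - p) \<le> e"
  shows "norm (y - p) \<le> 2 * e"
proof -
  have "(norm y)\<^sup>2 \<le> (norm p)\<^sup>2"
    using assms(1) by (simp add: power_mono)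
  then have "(norm (y - p))\<^sup>2 \<le> 2 * ((z - p) \<bullet> (y - p))"
    using assms(2) by (simp add: power2_norm_eq_inner inner_diff inner_commute)
  also have "\<dots> \<le> 2 * (norm (z - p) * norm (y - p))"
    by (simp add: norm_cauchy_schwarz)
  also have "\<dots> \<le> 2 * (e * norm (y - p))"
    using assms(3) by (simp add: mult_right_mono)
  finally have "norm (y - p) * norm (y - p) \<le> 2 * e * norm (y - p)"
    by (simp add: power2_eq_square)
  \<comment> \<open>If \<open>y = p\<close>, the common factor cannot be cancelled; the bound then
    rests on this sign.\<close>
  moreover have "0 \<le> e"
    using assms(3) norm_ge_zero order_trans by blast
  ultimately show ?thesis
    by (cases "norm (y - p) = 0") (simp_all add: mult_le_cancel_right)
qed

text \<open>Factor the difference of squares: the reverse triangle inequality bounds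
  \<open>norm p - norm y\<close> by \<open>d\<close>, and \<open>norm p + norm y\<close> is at most
  \<open>2 * norm p\<close>.\<close>

lemma norm_power2_diff_le:
  fixes y p :: "'a::real_normed_vector"
  assumes "norm y \<le> norm p" "norm (y - p) \<le> d"
  shows "(norm p)\<^sup>2 - (norm y)\<^sup>2 \<le> 2 * norm p * d"
proof -
  have "norm p - norm y \<le> d"
    using norm_triangle_ineq2[of p y] assms(2) by (simp add: norm_minus_commute)
  then have "(norm p - norm y) * (norm p + norm y) \<le> d * (2 * norm p)"
    using assms(1) by (intro mult_mono') simp_all
  then show ?thesis
    by (simp add: power2_eq_square algebra_simps)
qed

text \<open>A combination with both weights positive, of points not both equal to \<open>p\<close>,
  gives positive weight to a strict inequality.\<close>

lemma convex_insert_halfspace_lt: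
  fixes a p :: "'a::real_inner"
  shows "convex (insert p {y. a \<bullet> y < a \<bullet> p})"
proof (rule convexI)
  fix x y :: 'a and u v :: real
  assume xy: "x \<in> insert p {y. a \<bullet> y < a \<bullet> p}" "y \<in> insert p {y. a \<bullet> y < a \<bullet> p}"
    and uv: "0 \<le> u" "0 \<le> v" "u + v = 1"
  have v: "v = 1 - u" using uv by simp
  show "u *\<^sub>R x + v *\<^sub>R y \<in> insert p {y. a \<bullet> y < a \<bullet> p}"
  proof (cases "u = 0 \<or> v = 0 \<or> x = p \<and> y = p")
    case True
    then show ?thesis
      using xy uv by (auto simp flip: scaleR_add_left)
  next
    case False
    then have "u > 0" "v > 0" using uv by auto
    then have "u * (a \<bullet> x) + v * (a \<bullet> y) < u * (a \<bullet> p) + v * (a \<bullet> p)"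
      using xy False by (auto intro: add_le_less_mono add_less_le_mono add_strict_mono)
    also have "\<dots> = a \<bullet> p"
      using uv by (simp flip: distrib_right)
    finally show ?thesis by (simp add: inner_add_right)
  qed
qed

text \<open>The witness \<open>z\<close> makes the finite set of distances nonempty, so
  \<open>Min\<close> is attained at a shadow other than \<open>y\<close>.\<close>

lemma shadow_gap_pos_le:
  assumes "finite (shadow_set B X)" "z \<in> shadow_set B X" "z \<noteq> y"
  shows "0 < shadow_gap B X y"
    and "shadow_gap B X y \<le> norm (z - y)"
proof -
  let ?D = "{norm (z - y) |z. z \<in> shadow_set B X \<and> z \<noteq> y}"
  have fin: "finite ?D" using assms(1) by simp
  have mem: "norm (z - y) \<in> ?D" using assms(2,3) by blast
  then have "?D \<noteq> {}" by blast
  with Min_in[OF fin] Min_le[OF fin mem]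
  have "Min ?D \<in> ?D" "Min ?D \<le> norm (z - y)" by blast+
  then show "0 < shadow_gap B X y" "shadow_gap B X y \<le> norm (z - y)"
    unfolding shadow_gap_def by auto
qed

theorem theorem3p4:
  fixes X :: "(real^'n) set"
    and B :: "real^'r^'n"
    and ystar zhat yhat :: "real^'r"
    and \<epsilon> :: real
  assumes "X \<noteq> {}"
    and "compact X"
    and "optimal_shadow B X ystar"
    and "norm (zhat - ystar) \<le> \<epsilon>"
    and "is_arg_max (\<lambda>y. zhat \<bullet> y) (\<lambda>y. y \<in> shadow_hull B X) yhat"
  shows "norm (yhat - ystar) \<le> 2 * \<epsilon>
    \<and> 0 \<le> (norm ystar)\<^sup>2 - (norm yhat)\<^sup>2
    \<and> (norm ystar)\<^sup>2 - (norm yhat)\<^sup>2 \<le> 4 * norm ystar * \<epsilon>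
    \<and> (shadow_set B X = {ystar} \<longrightarrow> yhat = ystar)
    \<and> (shadow_set B X \<noteq> {ystar} \<and> finite (shadow_set B X) \<longrightarrow>
         0 < shadow_gap B X ystar \<and> (\<epsilon> < shadow_gap B X ystar / 2 \<longrightarrow> yhat = ystar))"
proof (intro conjI impI)
  have ystar: "ystar \<in> shadow_set B X"
    and S_le: "\<And>y. y \<in> shadow_set B X \<Longrightarrow> norm y \<le> norm ystar"
    using assms(3)
    by (auto simp: optimal_shadow_iff_is_arg_max_norm is_arg_max_def not_less)
  have hull_le: "norm y \<le> norm ystar" if "y \<in> shadow_hull B X" for y
  proof -
    have "shadow_hull B X \<subseteq> cball 0 (norm ystar)"
      unfolding shadow_hull_def using S_le by (intro hull_minimal) auto
    then show ?thesis using that by auto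
  qed
  have yhat: "yhat \<in> shadow_hull B X"
    using assms(5) by (simp add: is_arg_max_def)
  have "ystar \<in> shadow_hull B X"
    using ystar by (simp add: shadow_hull_def hull_inc)
  then have ge: "zhat \<bullet> ystar \<le> zhat \<bullet> yhat"
    using assms(5) by (auto simp: is_arg_max_def not_less)
  show dist: "norm (yhat - ystar) \<le> 2 * \<epsilon>"
    using norm_diff_le_of_inner_ge[OF hull_le[OF yhat] ge assms(4)] .
  show "0 \<le> (norm ystar)\<^sup>2 - (norm yhat)\<^sup>2"
    using hull_le[OF yhat] by (simp add: power_mono)
  show "(norm ystar)\<^sup>2 - (norm yhat)\<^sup>2 \<le> 4 * norm ystar * \<epsilon>"
    using norm_power2_diff_le[OF hull_le[OF yhat] dist] by simp
  show "yhat = ystar" if "shadow_set B X = {ystar}"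
    using yhat that by (simp add: shadow_hull_def)
  assume fin: "shadow_set B X \<noteq> {ystar} \<and> finite (shadow_set B X)"
  then obtain z where "z \<in> shadow_set B X" "z \<noteq> ystar"
    using ystar by blast
  with fin show "0 < shadow_gap B X ystar"
    by (blast intro: shadow_gap_pos_le(1))
  assume eps: "\<epsilon> < shadow_gap B X ystar / 2"
  have "zhat \<bullet> y < zhat \<bullet> ystar" if y: "y \<in> shadow_set B X" "y \<noteq> ystar" for y
  proof (rule ccontr)
    assume "\<not> zhat \<bullet> y < zhat \<bullet> ystar"
    then have "norm (y - ystar) \<le> 2 * \<epsilon>"
      using norm_diff_le_of_inner_ge[OF S_le[OF y(1)] _ assms(4)] by simp
    moreover have "shadow_gap B X ystar \<le> norm (y - ystar)"
      using shadow_gap_pos_le(2) fin y by blast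
    ultimately show False using eps by simp
  qed
  then have "shadow_hull B X \<subseteq> insert ystar {y. zhat \<bullet> y < zhat \<bullet> ystar}"
    unfolding shadow_hull_def by (intro hull_minimal convex_insert_halfspace_lt) auto
  \<comment> \<open>As a maximizer, \<open>yhat\<close> cannot lie in the open half-space, which
    leaves only the inserted point.\<close>
  then show "yhat = ystar" using yhat ge by auto
qed

end
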